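(* Let $f:\mathbb{R}^d\to\mathbb{R}$ be coordinate-wise glocally $(L,L_*,\delta)$-smooth and $\mu$-strongly convex with $\mu>0$, and let $f_*$ be its infimum. Let $w_0\in\mathbb{R}^d$, $\Delta_0=f(w_0)-f_*$, let $\epsilon$ satisfy $\Delta_0>\delta>\epsilon>0$, and let $\zeta\in(0,1)$. For all $t\ge0$ let $$w_{t+1}=w_t-\eta_t\nabla_{j_t}f(w_t)e_{j_t},\qquad \eta_t\in\arg\min_\eta f(w_t-\eta\nabla_{j_t}f(w_t)e_{j_t}),$$ where the $j_t$ are selected independently from the uniform distribution over $\{1,\dots,d\}$. Let $t_\delta=\left\lceil\frac{dL}{\mu}\log\left(\frac{\Delta_0}{\delta\zeta}\right)\right\rceil$ and let $X_\delta$ be the event that $f(w_{t_\delta})-f_*\le\delta$. Then $X_\delta$ has probability at least $1-\zeta$, and conditionally on it $$E[f(w_T)\mid X_\delta]-f_*\le\epsilon$$ for all integers $T$ with $$T\ge\frac{dL}{\mu}\log\left(\frac{\Delta_0}{\delta\zeta}\right)+\frac{dL_*}{\mu}\log\left(\frac{\delta}{\epsilon}\right)+1.$$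
   Context: Functions are differentiable and $L,L_*,\delta>0$. $\nabla_jf(w)$ is the $j$th coordinate of $\nabla f(w)$ and $e_j$ is the $j$th standard basis vector. The expectation is over the random coordinate selections, conditioned on the event $X_\delta$. Coordinate-wise glocal smoothness: $f$ is coordinate-wise glocally $(L,L_*,\delta)$-smooth if (i) $|\nabla_jf(u+\alpha e_j)-\nabla_jf(u)|\le L|\alpha|$ for all $u\in\mathbb{R}^d$, $j\in\{1,\dots,d\}$, $\alpha\in\mathbb{R}$, and (ii) $|\nabla_jf(u+\alpha e_j)-\nabla_jf(u)|\le L_*|\alpha|$ whenever $u$ and $u+\alpha e_j$ both lie in $\{u:f(u)-f_*\le\delta\}$. Strong convexity: $f$ is $\mu$-strongly convex if $f(v)\ge f(u)+\langle\nabla f(u),v-u\rangle+\frac{\mu}{2}\|v-u\|^2$ for all $u,v\in\mathbb{R}^d$ (Euclidean norm). *)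

theory Defs
  imports "HOL-Probability.Probability"
begin

definition grad :: "('a::euclidean_space \<Rightarrow> real) \<Rightarrow> 'a \<Rightarrow> 'a" where
  "grad f x = (THE D. GDERIV f x :> D)"

lemma GDERIV_grad:
  fixes f :: "'a::euclidean_space \<Rightarrow> real"
  assumes "f differentiable (at x)"
  shows "GDERIV f x :> grad f x"
proof -
  obtain f' where f': "(f has_derivative f') (at x)"
    using assms unfolding differentiable_def by blast
  then have lin: "linear f'"
    using has_derivative_linear by blast
  have rep: "f' = (\<lambda>h. h \<bullet> adjoint f' 1)"
  proof
    fix h
    show "f' h = h \<bullet> adjoint f' 1"
      using adjoint_works[OF lin, of h 1] by simp
  qed
  have ex: "GDERIV f x :> adjoint f' 1"
    unfolding gderiv_def using f' rep by metis
  have "D = adjoint f' 1" if "GDERIV f x :> D" for D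
  proof -
    have "(\<lambda>h. h \<bullet> D) = f'"
      using that f' unfolding gderiv_def by (rule has_derivative_unique)
    then have "\<forall>h. h \<bullet> D = h \<bullet> adjoint f' 1"
      using rep by metis
    then show ?thesis
      using vector_eq_ldot by blast
  qed
  with ex show ?thesis
    unfolding grad_def by (rule theI2)
qed

lemma grad_eq:
  fixes f :: "'a::euclidean_space \<Rightarrow> real"
  assumes D: "GDERIV f x :> D"
  shows "grad f x = D"
proof -
  have "f differentiable (at x)"
    using D unfolding gderiv_def differentiable_def by blast
  then have "GDERIV f x :> grad f x"
    by (rule GDERIV_grad)
  then have "(\<lambda>h. h \<bullet> grad f x) = (\<lambda>h. h \<bullet> D)"
    using D unfolding gderiv_def by (rule has_derivative_unique)
  then have "\<forall>h. h \<bullet> grad f x = h \<bullet> D"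
    by metis
  then show ?thesis
    using vector_eq_ldot by blast
qed

definition coord_glocally_smooth ::
    "real \<Rightarrow> real \<Rightarrow> real \<Rightarrow> (real ^ 'n \<Rightarrow> real) \<Rightarrow> bool" where
  "coord_glocally_smooth L Ls \<delta> f \<longleftrightarrow>
     (\<forall>u j \<alpha>. \<bar>grad f (u + \<alpha> *\<^sub>R axis j 1) $ j - grad f u $ j\<bar> \<le> L * \<bar>\<alpha>\<bar>) \<and>
     (\<forall>u j \<alpha>. f u - (INF v. f v) \<le> \<delta> \<longrightarrow>
        f (u + \<alpha> *\<^sub>R axis j 1) - (INF v. f v) \<le> \<delta> \<longrightarrow>
        \<bar>grad f (u + \<alpha> *\<^sub>R axis j 1) $ j - grad f u $ j\<bar> \<le> Ls * \<bar>\<alpha>\<bar>)"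

definition strongly_convex :: "real \<Rightarrow> (real ^ 'n \<Rightarrow> real) \<Rightarrow> bool" where
  "strongly_convex \<mu> f \<longleftrightarrow>
     (\<forall>u v. f v \<ge> f u + grad f u \<bullet> (v - u) + \<mu> / 2 * (norm (v - u))\<^sup>2)"

end

theory Submission
  imports Defs
begin

text \<open>
  An exact line search along coordinate \<open>i\<close> decreases \<open>f\<close> by at least
  \<open>(\<nabla>\<^sub>i f)\<^sup>2 / (2 K)\<close>, where \<open>K\<close> has to bound the rate of change of the partial derivative only on
  the part of the line where \<open>f\<close> does not exceed its current value: by convexity that part
  contains the whole segment to the minimiser, and the gradient step of length \<open>1 / K\<close> does not
  overshoot it (\<open>exact_line_search_decrease\<close>).  So \<open>K = L\<close> is always valid, and \<open>K = Ls\<close> is valid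
  once the gap \<open>f u - inf f\<close> is at most \<open>\<delta>\<close>.  Averaging over a uniformly random coordinate gives
  \<open>\<parallel>\<nabla>f\<parallel>\<^sup>2 / (2 d K)\<close>, and the Polyak-Lojasiewicz inequality turns this into a contraction of the
  mean gap by \<open>1 - \<mu> / (d K) \<le> exp (- \<mu> / (d K))\<close> (\<open>mean_step_contraction\<close>).

  The minimiser on a line is unique, so the iterate at time \<open>t\<close> is a fixed function of the first
  \<open>t\<close> coordinate choices, whatever step sizes \<open>\<eta>\<close> the line search returns.  Every iterate
  therefore takes finitely many values, and conditioning on the past is averaging
  over the last entry of a list (\<open>expectation_history_Suc\<close>); one-step contractions compose to
  geometric decay in expectation (\<open>expectation_geometric_decay\<close>).

  The theorem uses this decay twice.  With \<open>K = L\<close> it brings the mean gap below \<open>\<delta> \<zeta>\<close> by time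
  \<open>t\<^sub>\<delta>\<close>, and Markov's inequality gives \<open>X\<^sub>\<delta>\<close> probability at least \<open>1 - \<zeta>\<close>.  Since the gap never
  increases along a run, on \<open>X\<^sub>\<delta>\<close> it stays below \<open>\<delta>\<close> from then on, so the gap times the
  indicator of \<open>X\<^sub>\<delta>\<close> decays with \<open>K = Ls\<close>.  It starts with mean at most \<open>\<delta> P(X\<^sub>\<delta>)\<close>, and the factor
  \<open>P(X\<^sub>\<delta>)\<close> cancels on passing to the conditional expectation.
\<close>

section \<open>Exact line search on a convex function of one variable\<close>

text \<open>
  The Lipschitz bound at the minimiser \<open>a\<close>, where the slope vanishes, gives
  \<open>\<bar>\<phi>' 0\<bar> / K \<le> \<bar>a\<bar>\<close>, and by convexity \<open>- \<phi>' 0\<close> points towards \<open>a\<close>, so the gradient step from \<open>0\<close> to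
  \<open>- \<phi>' 0 / K\<close> ends on the segment between \<open>0\<close> and \<open>a\<close>.  The usual descent lemma thus only integrates over points of the
  sublevel set, where the bound on \<open>\<phi>'\<close> is available.
\<close>
lemma exact_line_search_decrease:
  fixes \<phi> \<phi>' :: "real \<Rightarrow> real" and a K :: real
  assumes deriv: "\<And>s. (\<phi> has_real_derivative \<phi>' s) (at s)"
    and conv: "\<And>r s. \<phi> r + \<phi>' r * (s - r) \<le> \<phi> s"
    and "K > 0"
    and lip: "\<And>s. \<phi> s \<le> \<phi> 0 \<Longrightarrow> \<bar>\<phi>' s - \<phi>' 0\<bar> \<le> K * \<bar>s\<bar>"
    and min: "\<And>s. \<phi> a \<le> \<phi> s"
  shows "\<phi> a \<le> \<phi> 0 - (\<phi>' 0)\<^sup>2 / (2 * K)"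
proof (cases "\<phi>' 0 = 0")
  case True
  then show ?thesis using min[of 0] by simp
next
  case False
  have stationary: "\<phi>' a = 0"
    using DERIV_local_min[OF deriv[of a], of 1] min by simp
  have slope_le: "\<bar>\<phi>' 0\<bar> \<le> K * \<bar>a\<bar>"
    using lip[OF min[of 0]] stationary by simp
  then have "a \<noteq> 0" using False by auto
  have descent: "a * \<phi>' 0 \<le> 0"
    using conv[of 0 a] min[of 0] by (simp add: mult.commute)
  \<comment> \<open>At a point of the segment above both end values, the tangent would have to fall in both
    directions.\<close>
  have in_sublevel: "\<phi> (\<theta> * a) \<le> \<phi> 0" if "0 \<le> \<theta>" "\<theta> \<le> 1" for \<theta>
  proof (rule ccontr)
    assume "\<not> ?thesis"
    then have "\<theta> * (a * \<phi>' (\<theta> * a)) > 0" "(1 - \<theta>) * (a * \<phi>' (\<theta> * a)) < 0"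
      using conv[of "\<theta> * a" 0] conv[of "\<theta> * a" a] min[of 0] by (simp_all add: algebra_simps)
    then show False
      using that by (auto simp: zero_less_mult_iff mult_less_0_iff)
  qed
  \<comment> \<open>Up to the constant \<open>\<phi> 0\<close>, the excess of \<open>\<phi>\<close> over its quadratic upper model along the segment;
    the descent lemma amounts to \<open>h\<close> being nonincreasing.\<close>
  define h where "h \<theta> = \<phi> (\<theta> * a) - \<theta> * a * \<phi>' 0 - K * (\<theta> * a)\<^sup>2 / 2" for \<theta>
  have h_deriv: "(h has_real_derivative a * (\<phi>' (\<theta> * a) - \<phi>' 0) - K * \<theta> * a\<^sup>2) (at \<theta>)" for \<theta>
    unfolding h_def
    by (auto intro!: derivative_eq_intros DERIV_chain2[OF deriv] simp: power2_eq_square algebra_simps)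
  have h_slope: "a * (\<phi>' (\<theta> * a) - \<phi>' 0) - K * \<theta> * a\<^sup>2 \<le> 0" if "0 \<le> \<theta>" "\<theta> \<le> 1" for \<theta>
  proof -
    have "a * (\<phi>' (\<theta> * a) - \<phi>' 0) \<le> \<bar>a\<bar> * \<bar>\<phi>' (\<theta> * a) - \<phi>' 0\<bar>"
      by (metis abs_ge_self abs_mult)
    also have "\<dots> \<le> \<bar>a\<bar> * (K * \<bar>\<theta> * a\<bar>)"
      using lip[OF in_sublevel[OF that]] by (intro mult_left_mono) auto
    also have "\<dots> = K * \<theta> * a\<^sup>2"
      using that by (simp add: abs_mult power2_eq_square)
    finally show ?thesis by simp
  qed
  \<comment> \<open>The position on the segment of the gradient step of length \<open>1 / K\<close>.\<close>
  define \<theta> where "\<theta> = - \<phi>' 0 / (K * a)"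
  have \<theta>a: "\<theta> * a = - \<phi>' 0 / K"
    using \<open>a \<noteq> 0\<close> by (simp add: \<theta>_def)
  have "\<theta> = - (a * \<phi>' 0) / (K * a\<^sup>2)"
    using \<open>a \<noteq> 0\<close> by (simp add: \<theta>_def power2_eq_square)
  moreover have "- (a * \<phi>' 0) / (K * a\<^sup>2) \<ge> 0"
    using descent \<open>K > 0\<close> by (intro divide_nonneg_nonneg) auto
  ultimately have "0 \<le> \<theta>" by simp
  have "\<bar>\<theta>\<bar> \<le> 1"
    using slope_le \<open>K > 0\<close> \<open>a \<noteq> 0\<close> by (simp add: \<theta>_def abs_mult divide_le_eq)
  then have "\<theta> \<le> 1" by simp
  have "h \<theta> \<le> h 0"
    using \<open>0 \<le> \<theta>\<close> \<open>\<theta> \<le> 1\<close> h_deriv h_slope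
    by (intro DERIV_nonpos_imp_nonincreasing[of 0 \<theta> h]) (meson order_trans)+
  then have "\<phi> (\<theta> * a) \<le> \<phi> 0 - (\<phi>' 0)\<^sup>2 / (2 * K)"
    using \<open>K > 0\<close> by (simp add: h_def \<theta>a power2_eq_square)
  with min[of "\<theta> * a"] show ?thesis by simp
qed

section \<open>Coordinate line search on a strongly convex function\<close>

locale coordinate_line_search =
  fixes f :: "real ^ 'n \<Rightarrow> real" and \<mu> :: real
  assumes differentiable: "\<And>x. f differentiable (at x)"
    and \<mu>_pos: "\<mu> > 0"
    and strongly_convex: "strongly_convex \<mu> f"
begin

lemma strongly_convexD:
  "f u + grad f u \<bullet> (v - u) + \<mu> / 2 * (norm (v - u))\<^sup>2 \<le> f v"
  using strongly_convex by (simp add: strongly_convex_def)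

lemma coordinate_line_derivative:
  "((\<lambda>s. f (u + s *\<^sub>R axis i 1)) has_real_derivative grad f (u + s *\<^sub>R axis i 1) $ i) (at s)"
proof -
  have "((\<lambda>s. u + s *\<^sub>R axis i 1) has_derivative (\<lambda>h. h *\<^sub>R axis i 1)) (at s)"
    by (auto intro!: derivative_eq_intros)
  moreover have "(f has_derivative (\<lambda>h. h \<bullet> grad f (u + s *\<^sub>R axis i 1))) (at (u + s *\<^sub>R axis i 1))"
    using GDERIV_grad[OF differentiable] by (simp add: gderiv_def)
  ultimately have "((\<lambda>s. f (u + s *\<^sub>R axis i 1)) has_derivative
      (\<lambda>h. (h *\<^sub>R axis i 1) \<bullet> grad f (u + s *\<^sub>R axis i 1))) (at s)"
    by (rule has_derivative_compose)
  then show ?thesis unfolding has_field_derivative_def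
    by (rule has_derivative_eq_rhs) (simp add: fun_eq_iff inner_axis' mult.commute)
qed

lemma coordinate_line_strongly_convex:
  "f (u + r *\<^sub>R axis i 1) + grad f (u + r *\<^sub>R axis i 1) $ i * (s - r) + \<mu> / 2 * (s - r)\<^sup>2
     \<le> f (u + s *\<^sub>R axis i 1)"
proof -
  have "u + s *\<^sub>R axis i 1 - (u + r *\<^sub>R axis i 1) = (s - r) *\<^sub>R axis i (1::real)"
    by (simp add: algebra_simps)
  with strongly_convexD[of "u + r *\<^sub>R axis i 1" "u + s *\<^sub>R axis i 1"] show ?thesis
    by (simp add: inner_axis mult.commute)
qed

lemma coordinate_line_convex:
  "f (u + r *\<^sub>R axis i 1) + grad f (u + r *\<^sub>R axis i 1) $ i * (s - r) \<le> f (u + s *\<^sub>R axis i 1)"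
proof -
  have "0 \<le> \<mu> / 2 * (s - r)\<^sup>2" using \<mu>_pos by simp
  with coordinate_line_strongly_convex[of u r i s] show ?thesis by linarith
qed

text \<open>
  Outside \<open>[- 2 \<bar>g\<bar> / \<mu>, 2 \<bar>g\<bar> / \<mu>]\<close>, with \<open>g\<close> the partial derivative at \<open>u\<close>, the quadratic term
  of strong convexity dominates the linear one, so the function exceeds its value at \<open>u\<close> and
  the minimum over this compact interval is global.
\<close>
lemma coordinate_minimizer_exists:
  "\<exists>a. \<forall>s. f (u + a *\<^sub>R axis i 1) \<le> f (u + s *\<^sub>R axis i 1)"
proof -
  define \<phi> where "\<phi> s = f (u + s *\<^sub>R axis i 1)" for s
  define g where "g = grad f u $ i"
  define R where "R = 2 * \<bar>g\<bar> / \<mu>"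
  have "R \<ge> 0" using \<mu>_pos by (simp add: R_def)
  have "continuous_on {-R..R} \<phi>"
    unfolding \<phi>_def
    by (intro continuous_at_imp_continuous_on ballI DERIV_isCont[OF coordinate_line_derivative])
  then have "\<exists>a\<in>{-R..R}. \<forall>s\<in>{-R..R}. \<phi> a \<le> \<phi> s"
    using \<open>R \<ge> 0\<close> by (intro continuous_attains_inf) auto
  then obtain a where a: "\<And>s. s \<in> {-R..R} \<Longrightarrow> \<phi> a \<le> \<phi> s" by blast
  have "\<phi> a \<le> \<phi> s" for s
  proof (cases "s \<in> {-R..R}")
    case False
    then have "R \<le> \<bar>s\<bar>" by auto
    then have "\<bar>g\<bar> \<le> \<mu> / 2 * \<bar>s\<bar>"
      using \<mu>_pos by (simp add: R_def divide_le_eq mult.commute)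
    then have "\<bar>g\<bar> * \<bar>s\<bar> \<le> \<mu> / 2 * \<bar>s\<bar> * \<bar>s\<bar>"
      by (rule mult_right_mono) simp
    moreover have "- (g * s) \<le> \<bar>g\<bar> * \<bar>s\<bar>"
      by (metis abs_ge_minus_self abs_mult)
    ultimately have "0 \<le> g * s + \<mu> / 2 * s\<^sup>2"
      by (simp add: power2_eq_square mult.assoc)
    then have "\<phi> 0 \<le> \<phi> s"
      using coordinate_line_strongly_convex[of u 0 i s] by (simp add: \<phi>_def g_def)
    moreover have "\<phi> a \<le> \<phi> 0" using a[of 0] \<open>R \<ge> 0\<close> by simp
    ultimately show ?thesis by simp
  qed (rule a)
  then show ?thesis unfolding \<phi>_def by blast
qed

lemma coordinate_minimizer_unique:
  assumes a: "\<And>s. f (u + a *\<^sub>R axis i 1) \<le> f (u + s *\<^sub>R axis i 1)"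
    and b: "\<And>s. f (u + b *\<^sub>R axis i 1) \<le> f (u + s *\<^sub>R axis i 1)"
  shows "a = b"
proof (rule ccontr)
  assume "a \<noteq> b"
  have "grad f (u + a *\<^sub>R axis i 1) $ i = 0"
    using DERIV_local_min[OF coordinate_line_derivative, of 1 a] a by simp
  moreover have "\<mu> / 2 * (b - a)\<^sup>2 > 0"
    using \<mu>_pos \<open>a \<noteq> b\<close> by simp
  ultimately show False
    using coordinate_line_strongly_convex[of u a i b] b[of a] by simp
qed

text \<open>
  The line is parametrised by the displacement rather than by the step size.  Unlike the
  optimal step size, the optimal displacement is unique also where the partial derivative
  vanishes, so the choice operator picks a determined point.
\<close>
definition step :: "real ^ 'n \<Rightarrow> 'n \<Rightarrow> real ^ 'n" where
  "step u i = u + (SOME a. \<forall>s. f (u + a *\<^sub>R axis i 1) \<le> f (u + s *\<^sub>R axis i 1)) *\<^sub>R axis i 1"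

lemma step_minimizes:
  "\<exists>a. step u i = u + a *\<^sub>R axis i 1 \<and>
    (\<forall>s. f (u + a *\<^sub>R axis i 1) \<le> f (u + s *\<^sub>R axis i 1))"
  by (intro exI conjI) (rule step_def, rule someI_ex[OF coordinate_minimizer_exists[of u i]])

lemma step_nonincreasing: "f (step u i) \<le> f u"
  using step_minimizes[of u i] by (metis add.right_neutral scaleR_zero_left)

lemma foldl_step_nonincreasing: "f (foldl step u l) \<le> f u"
  using step_nonincreasing by (induction l arbitrary: u) (auto intro: order_trans)

text \<open>
  If the partial derivative is nonzero, the step sizes parametrise the whole line, and minimisers
  on it are unique.  If it is zero, the step size is arbitrary but the point does not move, and by
  convexity it is already the minimiser.
\<close>
lemma gradient_line_search_eq_step:
  assumes "is_arg_min (\<lambda>s. f (u - (s * grad f u $ i) *\<^sub>R axis i 1)) (\<lambda>_. True) \<eta>"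
  shows "u - (\<eta> * grad f u $ i) *\<^sub>R axis i 1 = step u i"
proof -
  obtain a where a: "step u i = u + a *\<^sub>R axis i 1"
      "\<And>s. f (u + a *\<^sub>R axis i 1) \<le> f (u + s *\<^sub>R axis i 1)"
    using step_minimizes[of u i] by blast
  define g where "g = grad f u $ i"
  have min: "f (u + (- \<eta> * g) *\<^sub>R axis i 1) \<le> f (u + (- s * g) *\<^sub>R axis i 1)" for s
    using assms by (simp add: is_arg_min_linorder g_def)
  have "f (u + (- \<eta> * g) *\<^sub>R axis i 1) \<le> f (u + s *\<^sub>R axis i 1)" for s
  proof (cases "g = 0")
    case True
    then show ?thesis
      using coordinate_line_convex[of u 0 i s] by (simp add: g_def)
  next
    case False
    then show ?thesis using min[of "- s / g"] by simp
  qed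
  from coordinate_minimizer_unique[OF a(2) this] have "a = - \<eta> * g" .
  then show ?thesis using a(1) by (simp add: g_def)
qed

text \<open>
  Strong convexity bounds \<open>f v\<close> below by a quadratic in \<open>v\<close>; completing the square gives the
  minimum of that quadratic.
\<close>
lemma lower_bound_by_gradient: "f u - (norm (grad f u))\<^sup>2 / (2 * \<mu>) \<le> f v"
proof -
  have "0 \<le> (norm (grad f u + \<mu> *\<^sub>R (v - u)))\<^sup>2 / (2 * \<mu>)"
    using \<mu>_pos by simp
  also have "\<dots> = (norm (grad f u))\<^sup>2 / (2 * \<mu>) + grad f u \<bullet> (v - u) + \<mu> / 2 * (norm (v - u))\<^sup>2"
    using \<mu>_pos unfolding power2_norm_eq_inner
    by (simp only: inner_add_left inner_add_right inner_scaleR_left inner_scaleR_right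
        inner_commute[of "v - u" "grad f u"]) (simp add: field_simps power2_eq_square)
  finally show ?thesis using strongly_convexD[of u v] by simp
qed

lemma INF_le: "(INF v. f v) \<le> f u"
  using lower_bound_by_gradient[of u] by (intro cINF_lower bdd_belowI2[of _ "f u - _"]) auto

lemma polyak_lojasiewicz: "2 * \<mu> * (f u - (INF v. f v)) \<le> (norm (grad f u))\<^sup>2"
proof -
  have "f u - (norm (grad f u))\<^sup>2 / (2 * \<mu>) \<le> (INF v. f v)"
    using lower_bound_by_gradient by (intro cINF_greatest) auto
  then show ?thesis using \<mu>_pos by (simp add: field_simps)
qed

lemma step_decrease:
  fixes K :: real
  assumes "K > 0"
    and lip: "\<And>\<alpha>. f (u + \<alpha> *\<^sub>R axis i 1) \<le> f u \<Longrightarrow>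
      \<bar>grad f (u + \<alpha> *\<^sub>R axis i 1) $ i - grad f u $ i\<bar> \<le> K * \<bar>\<alpha>\<bar>"
  shows "f (step u i) \<le> f u - (grad f u $ i)\<^sup>2 / (2 * K)"
proof -
  obtain a where a: "step u i = u + a *\<^sub>R axis i 1"
      "\<And>s. f (u + a *\<^sub>R axis i 1) \<le> f (u + s *\<^sub>R axis i 1)"
    using step_minimizes[of u i] by blast
  show ?thesis
    using exact_line_search_decrease[OF coordinate_line_derivative coordinate_line_convex \<open>K > 0\<close> _ a(2)] lip a(1)
    by simp
qed

text \<open>
  The squares of the partial derivatives add up to \<open>\<parallel>\<nabla>f\<parallel>\<^sup>2\<close>, which the Polyak-Lojasiewicz inequality
  bounds below by a multiple of the gap.  The exponential replaces \<open>1 - \<mu> / (d K)\<close> because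
  it is nonnegative without comparing \<open>\<mu>\<close> with \<open>K\<close> and matches the logarithmic iteration counts.
\<close>
lemma mean_step_contraction:
  fixes K :: real
  assumes "K > 0"
    and lip: "\<And>i \<alpha>. f (u + \<alpha> *\<^sub>R axis i 1) \<le> f u \<Longrightarrow>
      \<bar>grad f (u + \<alpha> *\<^sub>R axis i 1) $ i - grad f u $ i\<bar> \<le> K * \<bar>\<alpha>\<bar>"
  shows "(\<Sum>i\<in>UNIV. f (step u i) - (INF v. f v)) / CARD('n)
    \<le> exp (- \<mu> / (CARD('n) * K)) * (f u - (INF v. f v))"
proof -
  define gap where "gap v = f v - (INF v. f v)" for v
  have "(\<Sum>i\<in>UNIV. gap (step u i)) \<le> (\<Sum>i\<in>UNIV. gap u - (grad f u $ i)\<^sup>2 / (2 * K))"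
    using step_decrease[OF \<open>K > 0\<close> lip] by (intro sum_mono) (simp add: gap_def)
  also have "\<dots> = CARD('n) * gap u - (norm (grad f u))\<^sup>2 / (2 * K)"
    by (simp add: sum_subtractf sum_divide_distrib[symmetric] norm_vec_def L2_set_def sum_nonneg)
  also have "\<dots> \<le> CARD('n) * gap u - \<mu> / K * gap u"
    using divide_right_mono[OF polyak_lojasiewicz[of u], of "2 * K"] \<open>K > 0\<close> by (simp add: gap_def)
  finally have "(\<Sum>i\<in>UNIV. gap (step u i)) / CARD('n) \<le> (1 - \<mu> / (CARD('n) * K)) * gap u"
    by (simp add: field_simps)
  also have "\<dots> \<le> exp (- \<mu> / (CARD('n) * K)) * gap u"
    using exp_ge_add_one_self[of "- \<mu> / (CARD('n) * K)"] INF_le[of u]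
    by (intro mult_right_mono) (auto simp: gap_def)
  finally show ?thesis by (simp add: gap_def)
qed

end

section \<open>Independent uniform choices from a finite type\<close>

locale uniform_choices = prob_space M for M :: "'a measure" +
  fixes j :: "nat \<Rightarrow> 'a \<Rightarrow> 'n::finite"
  assumes indep: "indep_vars (\<lambda>_. count_space UNIV) j UNIV"
    and uniform: "\<And>t. distr M (count_space UNIV) (j t) = uniform_count_measure UNIV"
begin

definition history :: "nat \<Rightarrow> 'a \<Rightarrow> 'n list" where
  "history t \<omega> = map (\<lambda>s. j s \<omega>) [0..<t]"

lemma history_0: "history 0 \<omega> = []"
  and history_Suc: "history (Suc t) \<omega> = history t \<omega> @ [j t \<omega>]"
  and length_history: "length (history t \<omega>) = t"
  by (simp_all add: history_def)

lemma take_history: "t \<le> T \<Longrightarrow> take t (history T \<omega>) = history t \<omega>"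
  by (simp add: history_def take_map)

lemma history_eq_iff: "length l = t \<Longrightarrow> history t \<omega> = l \<longleftrightarrow> (\<forall>s<t. j s \<omega> = l ! s)"
  by (auto simp: history_def list_eq_iff_nth_eq)

lemma measurable_choice [measurable]: "j t \<in> measurable M (count_space UNIV)"
  using indep by (simp add: indep_vars_def)

lemma prob_choice: "prob {\<omega> \<in> space M. j t \<omega> = i} = 1 / CARD('n)"
proof -
  have "prob {\<omega> \<in> space M. j t \<omega> = i} = measure (distr M (count_space UNIV) (j t)) {i}"
    by (subst measure_distr) (auto intro!: arg_cong[where f = prob])
  then show ?thesis
    by (simp add: uniform measure_uniform_count_measure)
qed

lemma measurable_history [measurable]: "history t \<in> measurable M (count_space UNIV)"
proof (induction t)
  case 0
  then show ?case by (simp add: history_0[abs_def])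
next
  case (Suc t)
  note Suc.IH [measurable]
  show ?case unfolding history_Suc[abs_def]
    by measurable
qed

lemma prob_history:
  assumes "length l = t"
  shows "prob {\<omega> \<in> space M. history t \<omega> = l} = (1 / CARD('n)) ^ t"
proof (cases "t = 0")
  case True
  then show ?thesis using assms prob_space by (simp add: history_0)
next
  case False
  have "{\<omega> \<in> space M. history t \<omega> = l} = (\<Inter>s\<in>{..<t}. j s -` {l ! s} \<inter> space M)"
    using False by (auto simp: history_eq_iff[OF assms])
  also have "prob \<dots> = (\<Prod>s\<in>{..<t}. prob (j s -` {l ! s} \<inter> space M))"
    using False by (intro indep_varsD_finite[OF indep_vars_subset[OF indep]]) auto
  also have "\<dots> = (\<Prod>s\<in>{..<t}. 1 / CARD('n))"
    using prob_choice by (intro prod.cong refl) (simp add: vimage_def Int_def conj_commute)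
  finally show ?thesis by simp
qed

lemma finite_lists: "finite {l :: 'n list. length l = t}"
  using finite_lists_length_eq[of "UNIV :: 'n set" t] by simp

lemma integrable_history: "integrable M (\<lambda>\<omega>. H (history t \<omega>) :: real)"
proof (rule integrable_const_bound)
  define B where "B = (\<Sum>l | length l = t. \<bar>H l\<bar>)"
  show "AE \<omega> in M. norm (H (history t \<omega>)) \<le> B"
    using member_le_sum[of _ "{l. length l = t}" "\<lambda>l. \<bar>H l\<bar>"] finite_lists
    by (auto simp: B_def length_history)
qed measurable

lemma expectation_history:
  "expectation (\<lambda>\<omega>. H (history t \<omega>)) = (\<Sum>l | length l = t. H l) / CARD('n) ^ t"
  for H :: "'n list \<Rightarrow> real"
proof -
  have "expectation (\<lambda>\<omega>. H (history t \<omega>)) =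
      expectation (\<lambda>\<omega>. \<Sum>l | length l = t. H l * indicator {\<omega> \<in> space M. history t \<omega> = l} \<omega>)"
  proof (intro Bochner_Integration.integral_cong refl)
    fix \<omega> assume "\<omega> \<in> space M"
    then have "(\<Sum>l | length l = t. H l * indicator {\<omega> \<in> space M. history t \<omega> = l} \<omega>) =
        (\<Sum>l | length l = t. if l = history t \<omega> then H l else 0)"
      by (intro sum.cong refl) (auto simp: indicator_def)
    also have "\<dots> = H (history t \<omega>)"
      using finite_lists by (simp add: sum.delta length_history)
    finally show "H (history t \<omega>) =
        (\<Sum>l | length l = t. H l * indicator {\<omega> \<in> space M. history t \<omega> = l} \<omega>)" ..
  qed
  also have "\<dots> = (\<Sum>l | length l = t. H l * prob {\<omega> \<in> space M. history t \<omega> = l})"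
    by (subst Bochner_Integration.integral_sum)
      (auto simp: less_top[symmetric] intro!: integrable_mult_right integrable_real_indicator)
  also have "\<dots> = (\<Sum>l | length l = t. H l / CARD('n) ^ t)"
    by (intro sum.cong refl) (simp add: prob_history power_divide)
  finally show ?thesis by (simp add: sum_divide_distrib)
qed

text \<open>
  The tower rule for conditioning on the first \<open>t\<close> choices.  As histories are uniformly distributed
  lists, it amounts to splitting off the last entry in a sum over lists of length \<open>Suc t\<close>.
\<close>
lemma expectation_history_Suc:
  "expectation (\<lambda>\<omega>. H (history (Suc t) \<omega>)) =
   expectation (\<lambda>\<omega>. (\<Sum>i\<in>UNIV. H (history t \<omega> @ [i])) / CARD('n))"
  for H :: "'n list \<Rightarrow> real"
proof -
  have "bij_betw (\<lambda>(l, i). l @ [i]) ({l. length l = t} \<times> (UNIV :: 'n set)) {l. length l = Suc t}"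
  proof (rule bij_betwI')
    fix l :: "'n list" assume "l \<in> {l. length l = Suc t}"
    then show "\<exists>p\<in>{l. length l = t} \<times> UNIV. l = (case p of (l, i) \<Rightarrow> l @ [i])"
      by (intro bexI[of _ "(butlast l, last l)"]) (auto, metis append_butlast_last_id length_0_conv nat.distinct(1))
  qed auto
  then have "(\<Sum>l | length l = Suc t. H l) = (\<Sum>(l, i)\<in>{l. length l = t} \<times> UNIV. H (l @ [i]))"
    by (subst sum.reindex_bij_betw[symmetric]) (simp_all add: case_prod_beta')
  then have "(\<Sum>l | length l = Suc t. H l) = (\<Sum>l | length l = t. \<Sum>i\<in>UNIV. H (l @ [i]))"
    by (simp add: sum.cartesian_product)
  then show ?thesis
    using expectation_history[of H "Suc t"] expectation_history[of "\<lambda>l. (\<Sum>i\<in>UNIV. H (l @ [i])) / CARD('n)" t]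
    by (simp add: sum_divide_distrib[symmetric])
qed

text \<open>
  The function \<open>V\<close> depends on the whole list of choices, not just on the current iterate, so that it
  may contain the indicator of an event decided by the first \<open>t\<close> choices.
\<close>
lemma expectation_geometric_decay:
  fixes V :: "'n list \<Rightarrow> real" and c :: real
  assumes "c \<ge> 0"
    and drift: "\<And>l. length l \<ge> t \<Longrightarrow> (\<Sum>i\<in>UNIV. V (l @ [i])) / CARD('n) \<le> c * V l"
  shows "expectation (\<lambda>\<omega>. V (history (t + n) \<omega>)) \<le> c ^ n * expectation (\<lambda>\<omega>. V (history t \<omega>))"
proof (induction n)
  case (Suc n)
  have "expectation (\<lambda>\<omega>. V (history (t + Suc n) \<omega>)) =
      expectation (\<lambda>\<omega>. (\<Sum>i\<in>UNIV. V (history (t + n) \<omega> @ [i])) / CARD('n))"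
    using expectation_history_Suc[of V "t + n"] by simp
  also have "\<dots> \<le> expectation (\<lambda>\<omega>. c * V (history (t + n) \<omega>))"
    using integrable_history[of "\<lambda>l. (\<Sum>i\<in>UNIV. V (l @ [i])) / CARD('n)" "t + n"]
      integrable_history[of V "t + n"] drift
    by (intro integral_mono) (auto simp: length_history)
  also have "\<dots> \<le> c * (c ^ n * expectation (\<lambda>\<omega>. V (history t \<omega>)))"
    using Suc.IH \<open>c \<ge> 0\<close> by (simp add: mult_left_mono)
  finally show ?case by (simp add: mult.assoc)
qed simp

end

section \<open>Conditional expectation given an event\<close>

lemma (in prob_space)
  fixes g :: "'a \<Rightarrow> real"
  assumes [measurable]: "A \<in> sets M" and "prob A > 0" and g: "integrable M g"
  shows integrable_uniform_measure: "integrable (uniform_measure M A) g"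
    and integral_uniform_measure:
      "(\<integral>\<omega>. g \<omega> \<partial>uniform_measure M A) = expectation (\<lambda>\<omega>. indicator A \<omega> * g \<omega>) / prob A"
proof -
  have [measurable]: "g \<in> borel_measurable M" using g by simp
  have density: "uniform_measure M A = density M (\<lambda>\<omega>. ennreal (indicator A \<omega> / prob A))"
    using \<open>prob A > 0\<close> unfolding uniform_measure_def
    by (simp add: emeasure_eq_measure divide_ennreal[symmetric] ennreal_indicator)
  show "integrable (uniform_measure M A) g"
    unfolding density using integrable_mult_indicator[OF \<open>A \<in> sets M\<close> g]
    by (subst integrable_density) auto
  show "(\<integral>\<omega>. g \<omega> \<partial>uniform_measure M A) = expectation (\<lambda>\<omega>. indicator A \<omega> * g \<omega>) / prob A"
    unfolding density by (subst integral_density) auto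
qed

section \<open>Two-phase convergence of coordinate descent\<close>

lemma real_nat_ceiling_le_add_one: "0 \<le> x \<Longrightarrow> real (nat \<lceil>x\<rceil>) \<le> x + 1"
  by linarith

lemma geometric_decay_time:
  fixes d K \<mu> a b :: real
  assumes "d > 0" "K > 0" "\<mu> > 0" "a > 0" "b > 0"
    and n: "d * K / \<mu> * ln (a / b) \<le> real n"
  shows "exp (- \<mu> / (d * K)) ^ n * a \<le> b"
proof -
  have "ln (a / b) = \<mu> / (d * K) * (d * K / \<mu> * ln (a / b))"
    using assms by simp
  also have "\<dots> \<le> \<mu> / (d * K) * real n"
    using assms by (intro mult_left_mono) auto
  finally have "real n * (- \<mu> / (d * K)) \<le> - ln (a / b)"
    by (simp add: mult.commute)
  then have "exp (- \<mu> / (d * K)) ^ n \<le> exp (- ln (a / b))"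
    by (simp only: exp_of_nat_mult[symmetric] exp_le_cancel_iff)
  also have "\<dots> = b / a"
    using assms by (simp add: exp_minus)
  finally show ?thesis
    using \<open>a > 0\<close> by (simp add: pos_le_divide_eq)
qed

theorem theorem6:
  fixes f :: "real ^ 'n \<Rightarrow> real"
    and L Ls \<delta> \<mu> \<epsilon> \<zeta> fs \<Delta>\<^sub>0 :: real
    and w\<^sub>0 :: "real ^ 'n"
    and M :: "'a measure"
    and j :: "nat \<Rightarrow> 'a \<Rightarrow> 'n"
    and \<eta> :: "nat \<Rightarrow> 'a \<Rightarrow> real"
    and w :: "nat \<Rightarrow> 'a \<Rightarrow> real ^ 'n"
    and t\<^sub>\<delta> :: nat
    and X\<^sub>\<delta> :: "'a set"
  assumes "\<And>x. f differentiable (at x)"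
    and "L > 0" and "Ls > 0"
    and "coord_glocally_smooth L Ls \<delta> f"
    and "\<mu> > 0" and "strongly_convex \<mu> f"
    and "fs = (INF x. f x)"
    and "\<Delta>\<^sub>0 = f w\<^sub>0 - fs"
    and "\<Delta>\<^sub>0 > \<delta>" and "\<delta> > \<epsilon>" and "\<epsilon> > 0"
    and "0 < \<zeta>" and "\<zeta> < 1"
    and "prob_space M"
    and "prob_space.indep_vars M (\<lambda>_. count_space UNIV) j UNIV"
    and "\<And>t. distr M (count_space UNIV) (j t) = uniform_count_measure UNIV"
    and "\<And>\<omega>. \<omega> \<in> space M \<Longrightarrow> w 0 \<omega> = w\<^sub>0"
    and "\<And>t \<omega>. \<omega> \<in> space M \<Longrightarrow>
           w (Suc t) \<omega> = w t \<omega> - (\<eta> t \<omega> * grad f (w t \<omega>) $ j t \<omega>) *\<^sub>R axis (j t \<omega>) 1"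
    and "\<And>t \<omega>. \<omega> \<in> space M \<Longrightarrow>
           is_arg_min (\<lambda>s. f (w t \<omega> - (s * grad f (w t \<omega>) $ j t \<omega>) *\<^sub>R axis (j t \<omega>) 1))
             (\<lambda>_. True) (\<eta> t \<omega>)"
    and "t\<^sub>\<delta> = nat \<lceil>real CARD('n) * L / \<mu> * ln (\<Delta>\<^sub>0 / (\<delta> * \<zeta>))\<rceil>"
    and "X\<^sub>\<delta> = {\<omega> \<in> space M. f (w t\<^sub>\<delta> \<omega>) - fs \<le> \<delta>}"
  shows "X\<^sub>\<delta> \<in> sets M \<and> measure M X\<^sub>\<delta> \<ge> 1 - \<zeta> \<and>
    (\<forall>T::nat.
       real T \<ge> real CARD('n) * L / \<mu> * ln (\<Delta>\<^sub>0 / (\<delta> * \<zeta>))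
              + real CARD('n) * Ls / \<mu> * ln (\<delta> / \<epsilon>) + 1 \<longrightarrow>
       integrable (uniform_measure M X\<^sub>\<delta>) (\<lambda>\<omega>. f (w T \<omega>)) \<and>
       (\<integral>\<omega>. f (w T \<omega>) \<partial>uniform_measure M X\<^sub>\<delta>) - fs \<le> \<epsilon>)"
proof -
  note smooth = assms(4) and fs = assms(7) and X_def = assms(21)
  interpret coordinate_line_search f \<mu>
    using assms(1,5,6) by unfold_locales
  interpret uniform_choices M j
    using assms(14-16) by (simp add: uniform_choices_def uniform_choices_axioms_def)
  define gap where "gap u = f u - fs" for u
  define W where "W = foldl step w\<^sub>0"
  have W_snoc: "W (l @ [i]) = step (W l) i" for l i
    by (simp add: W_def)
  have gap_nonneg: "0 \<le> gap u" for u
    using INF_le[of u] by (simp add: gap_def fs)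
  \<comment> \<open>Measurability and integrability along the run all come from this identity.\<close>
  have w_eq: "w t \<omega> = W (history t \<omega>)" if "\<omega> \<in> space M" for t \<omega>
  proof (induction t)
    case 0
    then show ?case using assms(17)[OF that] by (simp add: W_def history_0)
  next
    case (Suc t)
    then show ?case
      using assms(18)[OF that, of t] gradient_line_search_eq_step[OF assms(19)[OF that, of t]]
      by (simp add: history_Suc W_snoc)
  qed

  have contraction_L: "(\<Sum>i\<in>UNIV. gap (step u i)) / CARD('n) \<le> exp (- \<mu> / (CARD('n) * L)) * gap u" for u
    unfolding gap_def fs using smooth
    by (intro mean_step_contraction[OF \<open>L > 0\<close>]) (simp add: coord_glocally_smooth_def)
  have contraction_Ls: "(\<Sum>i\<in>UNIV. gap (step u i)) / CARD('n) \<le> exp (- \<mu> / (CARD('n) * Ls)) * gap u"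
    if "gap u \<le> \<delta>" for u
    unfolding gap_def fs using smooth that
    by (intro mean_step_contraction[OF \<open>Ls > 0\<close>]) (simp add: coord_glocally_smooth_def gap_def fs)

  have "\<delta> > 0" using assms(10,11) by simp
  have "\<Delta>\<^sub>0 > 0" using assms(9) \<open>\<delta> > 0\<close> by simp
  have X_sets [measurable]: "X\<^sub>\<delta> \<in> sets M"
  proof -
    have "X\<^sub>\<delta> = {\<omega> \<in> space M. gap (W (history t\<^sub>\<delta> \<omega>)) \<le> \<delta>}"
      using w_eq by (auto simp: X_def gap_def)
    then show ?thesis by simp
  qed

  have "expectation (\<lambda>\<omega>. gap (W (history t\<^sub>\<delta> \<omega>))) \<le> \<delta> * \<zeta>"
  proof -
    have "expectation (\<lambda>\<omega>. gap (W (history (0 + t\<^sub>\<delta>) \<omega>)))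
        \<le> exp (- \<mu> / (CARD('n) * L)) ^ t\<^sub>\<delta> * expectation (\<lambda>\<omega>. gap (W (history 0 \<omega>)))"
      using contraction_L
      by (intro expectation_geometric_decay[where V = "\<lambda>l. gap (W l)"]) (auto simp: W_snoc)
    also have "\<dots> = exp (- \<mu> / (CARD('n) * L)) ^ t\<^sub>\<delta> * \<Delta>\<^sub>0"
      by (simp add: history_0 W_def gap_def assms(8) prob_space)
    also have "\<dots> \<le> \<delta> * \<zeta>"
      using \<open>L > 0\<close> \<open>\<mu> > 0\<close> \<open>\<Delta>\<^sub>0 > 0\<close> \<open>\<delta> > 0\<close> \<open>0 < \<zeta>\<close> real_nat_ceiling_ge
      by (intro geometric_decay_time) (auto simp: assms(20))
    finally show ?thesis by simp
  qed
  moreover have "prob (space M - X\<^sub>\<delta>) \<le> prob {\<omega> \<in> space M. gap (W (history t\<^sub>\<delta> \<omega>)) \<ge> \<delta>}"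
    using w_eq by (intro finite_measure_mono) (auto simp: X_def gap_def)
  moreover have "\<dots> \<le> expectation (\<lambda>\<omega>. gap (W (history t\<^sub>\<delta> \<omega>))) / \<delta>"
    using integrable_history[of "\<lambda>l. gap (W l)"] gap_nonneg \<open>\<delta> > 0\<close>
    by (intro integral_Markov_inequality_measure[where A = "space M"]) auto
  moreover have "expectation (\<lambda>\<omega>. gap (W (history t\<^sub>\<delta> \<omega>))) / \<delta> \<le> \<zeta>"
    using calculation(1) \<open>\<delta> > 0\<close> by (simp add: pos_divide_le_eq mult.commute)
  ultimately have "prob (space M - X\<^sub>\<delta>) \<le> \<zeta>" by linarith
  then have prob_X: "prob X\<^sub>\<delta> \<ge> 1 - \<zeta>"
    using prob_compl[OF X_sets] by simp
  then have prob_X_pos: "prob X\<^sub>\<delta> > 0"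
    using \<open>\<zeta> < 1\<close> by simp

  have conditional: "integrable (uniform_measure M X\<^sub>\<delta>) (\<lambda>\<omega>. f (w T \<omega>)) \<and>
      (\<integral>\<omega>. f (w T \<omega>) \<partial>uniform_measure M X\<^sub>\<delta>) - fs \<le> \<epsilon>"
    if T: "real T \<ge> real CARD('n) * L / \<mu> * ln (\<Delta>\<^sub>0 / (\<delta> * \<zeta>))
              + real CARD('n) * Ls / \<mu> * ln (\<delta> / \<epsilon>) + 1" for T
  proof
    \<comment> \<open>A logarithm of at least \<open>0\<close> is needed so that the conversion to \<open>nat\<close> does not truncate; the
      summand \<open>1\<close> in the bound on \<open>T\<close> pays for the rounding up.\<close>
    have "1 \<le> \<Delta>\<^sub>0 / (\<delta> * \<zeta>)"
    proof -
      have "\<delta> * \<zeta> \<le> \<delta>" using \<open>\<delta> > 0\<close> \<open>\<zeta> < 1\<close> by (intro mult_left_le) auto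
      with assms(9) have "\<delta> * \<zeta> \<le> \<Delta>\<^sub>0" by linarith
      then show ?thesis using \<open>\<delta> > 0\<close> \<open>0 < \<zeta>\<close> by simp
    qed
    then have "real t\<^sub>\<delta> \<le> real CARD('n) * L / \<mu> * ln (\<Delta>\<^sub>0 / (\<delta> * \<zeta>)) + 1"
      using \<open>L > 0\<close> \<open>\<mu> > 0\<close> unfolding assms(20) by (intro real_nat_ceiling_le_add_one) simp
    then have "real CARD('n) * Ls / \<mu> * ln (\<delta> / \<epsilon>) \<le> real T - real t\<^sub>\<delta>"
      using T by simp
    moreover have "0 \<le> real CARD('n) * Ls / \<mu> * ln (\<delta> / \<epsilon>)"
      using \<open>Ls > 0\<close> \<open>\<mu> > 0\<close> assms(10,11) by simp
    ultimately have "t\<^sub>\<delta> \<le> T"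
        and remaining: "real CARD('n) * Ls / \<mu> * ln (\<delta> / \<epsilon>) \<le> real (T - t\<^sub>\<delta>)"
      by (simp_all add: of_nat_diff)

    \<comment> \<open>The gap restricted to \<open>X\<^sub>\<delta>\<close>, as a function of the choices: membership in \<open>X\<^sub>\<delta>\<close> is decided by the
      first \<open>t\<^sub>\<delta>\<close> of them.\<close>
    define V where "V l = (if gap (W (take t\<^sub>\<delta> l)) \<le> \<delta> then gap (W l) else 0)" for l
    have drift: "(\<Sum>i\<in>UNIV. V (l @ [i])) / CARD('n) \<le> exp (- \<mu> / (CARD('n) * Ls)) * V l"
      if "length l \<ge> t\<^sub>\<delta>" for l
    proof (cases "gap (W (take t\<^sub>\<delta> l)) \<le> \<delta>")
      case True
      have "W l = foldl step (W (take t\<^sub>\<delta> l)) (drop t\<^sub>\<delta> l)"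
        unfolding W_def foldl_append[symmetric] by simp
      \<comment> \<open>Line searches never increase \<open>f\<close>, so the run is still in the region where \<open>Ls\<close> applies.\<close>
      then have "gap (W l) \<le> \<delta>"
        using foldl_step_nonincreasing[of "W (take t\<^sub>\<delta> l)" "drop t\<^sub>\<delta> l"] True by (simp add: gap_def)
      then show ?thesis
        using contraction_Ls[of "W l"] that True by (simp add: V_def W_snoc)
    qed (use that in \<open>simp add: V_def\<close>)
    have V_history: "V (history T \<omega>) = indicator X\<^sub>\<delta> \<omega> * gap (w T \<omega>)" if "\<omega> \<in> space M" "t\<^sub>\<delta> \<le> T" for T \<omega>
      using that by (simp add: V_def take_history w_eq[symmetric] X_def gap_def)

    have "expectation (\<lambda>\<omega>. V (history t\<^sub>\<delta> \<omega>)) \<le> expectation (\<lambda>\<omega>. \<delta> * indicator X\<^sub>\<delta> \<omega>)"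
    proof (rule integral_mono)
      show "integrable M (\<lambda>\<omega>. V (history t\<^sub>\<delta> \<omega>))" by (rule integrable_history)
      show "integrable M (\<lambda>\<omega>. \<delta> * indicator X\<^sub>\<delta> \<omega>)"
        using X_sets by (simp add: less_top[symmetric])
      show "V (history t\<^sub>\<delta> \<omega>) \<le> \<delta> * indicator X\<^sub>\<delta> \<omega>" if "\<omega> \<in> space M" for \<omega>
        using V_history[OF that order_refl] by (simp add: indicator_def X_def gap_def)
    qed
    also have "\<dots> = \<delta> * prob X\<^sub>\<delta>" by simp
    finally have start: "expectation (\<lambda>\<omega>. V (history t\<^sub>\<delta> \<omega>)) \<le> \<delta> * prob X\<^sub>\<delta>" .
    have "expectation (\<lambda>\<omega>. V (history (t\<^sub>\<delta> + (T - t\<^sub>\<delta>)) \<omega>))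
        \<le> exp (- \<mu> / (CARD('n) * Ls)) ^ (T - t\<^sub>\<delta>) * expectation (\<lambda>\<omega>. V (history t\<^sub>\<delta> \<omega>))"
      using drift by (intro expectation_geometric_decay) auto
    also have "\<dots> \<le> exp (- \<mu> / (CARD('n) * Ls)) ^ (T - t\<^sub>\<delta>) * (\<delta> * prob X\<^sub>\<delta>)"
      using start by (intro mult_left_mono) auto
    also have "\<dots> \<le> \<epsilon> * prob X\<^sub>\<delta>"
      using geometric_decay_time[OF _ \<open>Ls > 0\<close> \<open>\<mu> > 0\<close> \<open>\<delta> > 0\<close> \<open>\<epsilon> > 0\<close> remaining]
        mult_right_mono[of _ \<epsilon> "prob X\<^sub>\<delta>"] by (simp add: mult.assoc[symmetric])
    finally have decayed: "expectation (\<lambda>\<omega>. V (history T \<omega>)) \<le> \<epsilon> * prob X\<^sub>\<delta>"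
      using \<open>t\<^sub>\<delta> \<le> T\<close> by simp

    have f_integrable: "integrable M (\<lambda>\<omega>. f (w T \<omega>))"
      using integrable_history[of "\<lambda>l. f (W l)" T]
      by (subst Bochner_Integration.integrable_cong[OF refl]) (auto simp: w_eq)
    show "integrable (uniform_measure M X\<^sub>\<delta>) (\<lambda>\<omega>. f (w T \<omega>))"
      by (rule integrable_uniform_measure[OF X_sets prob_X_pos f_integrable])
    have "expectation (\<lambda>\<omega>. indicator X\<^sub>\<delta> \<omega> * f (w T \<omega>)) =
        expectation (\<lambda>\<omega>. V (history T \<omega>) + fs * indicator X\<^sub>\<delta> \<omega>)"
      using V_history[OF _ \<open>t\<^sub>\<delta> \<le> T\<close>]
      by (intro Bochner_Integration.integral_cong refl) (simp add: gap_def algebra_simps)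
    also have "\<dots> = expectation (\<lambda>\<omega>. V (history T \<omega>)) + fs * prob X\<^sub>\<delta>"
      using integrable_history[of V T] X_sets
      by (subst Bochner_Integration.integral_add) (auto simp: less_top[symmetric])
    finally have "expectation (\<lambda>\<omega>. indicator X\<^sub>\<delta> \<omega> * f (w T \<omega>)) / prob X\<^sub>\<delta> \<le> \<epsilon> + fs"
      using decayed prob_X_pos by (simp add: pos_divide_le_eq algebra_simps)
    then show "(\<integral>\<omega>. f (w T \<omega>) \<partial>uniform_measure M X\<^sub>\<delta>) - fs \<le> \<epsilon>"
      using integral_uniform_measure[OF X_sets prob_X_pos f_integrable] by simp
  qed
  show ?thesis
    using X_sets prob_X conditional by blast
qed

end
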